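(* Let $X$ be a real Banach space, let $\varphi:X\to\mathbb{R}$ be a non-zero continuous linear functional, and let $\psi:X\to\mathbb{R}$ be a non-constant Lipschitzian functional with Lipschitz constant $L=\|\varphi\|_{X^*}$. Let $[a,b]$ be a closed interval contained in $[-1,1]$ and let $\gamma:[a,b]\to\mathbb{R}$ be a convex and lower semicontinuous function. Then $$\max\left\{\inf_{x\in X}(\varphi(x)+a\psi(x))-\gamma(a),\ \inf_{x\in X}(\varphi(x)+b\psi(x))-\gamma(b)\right\}=\inf_{x\in X}\sup_{\lambda\in[a,b]}\bigl(\varphi(x)+\lambda\psi(x)-\gamma(\lambda)\bigr).$$
   Context: $\|\varphi\|_{X^*}$ denotes the dual (operator) norm of $\varphi$. That $\psi$ is Lipschitzian with Lipschitz constant $L$ means $|\psi(x)-\psi(y)|\le L\|x-y\|$ for all $x,y\in X$. Infima are taken in the extended reals and may equal $-\infty$. *)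

theory Defs
  imports "HOL-Analysis.Analysis"
begin

text \<open>
  Lower semicontinuity is relative to the subspace topology of the domain \<open>S\<close>. The filter
  omits the point \<open>x\<close> itself, which is harmless because \<open>c < f x\<close> holds there anyway.
\<close>

definition lower_semicontinuous_on :: "'a::topological_space set \<Rightarrow> ('a \<Rightarrow> real) \<Rightarrow> bool"
  where "lower_semicontinuous_on S f \<longleftrightarrow>
    (\<forall>x\<in>S. \<forall>c<f x. eventually (\<lambda>y. c < f y) (at x within S))"

end

theory Submission
  imports Defs
begin

text \<open>
  Only the inequality \<open>\<ge>\<close> has content. Suppose that a real \<open>c\<close> lies strictly below the right-hand
  side. Then for every \<open>x\<close> the set \<open>I x\<close> of all \<open>l\<close> in \<open>[a, b]\<close> with
  \<open>c \<le> \<phi> x + l * \<psi> x - \<gamma> l\<close> is nonempty, and it is an interval because the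
  expression is concave in \<open>l\<close>. The goal is to find a single \<open>l\<close> that belongs to all the \<open>I x\<close>.

  By Helly's theorem on the line it suffices that any two of these compact intervals meet. If
  \<open>I y\<close> lay entirely to the left of some \<open>l\<close> and \<open>I x\<close> entirely to the right of it, then the
  sublevel set \<open>{x. l \<notin> I x}\<close> of \<open>\<phi> + l * \<psi>\<close> would split into two nonempty open parts: the
  points whose interval lies to the left of \<open>l\<close> and those whose interval lies to the right. So
  everything rests on the connectedness of these sublevel sets for \<open>a < l < b\<close>, that is, for
  certain \<open>l\<close> with \<open>\<bar>l\<bar> < 1\<close>. For such \<open>l\<close> the perturbation \<open>l * \<psi>\<close> has a Lipschitz constant
  strictly smaller than the norm of \<open>\<phi>\<close>, hence there is a direction \<open>u\<close> in which the sum
  \<open>\<phi> + l * \<psi>\<close> grows at least linearly from every starting point. Two points of a sublevel set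
  can then be joined inside it: move both far down along \<open>- u\<close> and cross over at the bottom.

  The same direction shows that \<open>\<phi> + l * \<psi>\<close> is unbounded below when \<open>\<bar>l\<bar> < 1\<close>. The common
  parameter \<open>l\<close> makes it bounded below, so \<open>\<bar>l\<bar> = 1\<close>, which forces \<open>l\<close> to be an endpoint of
  \<open>[a, b]\<close>. Membership of \<open>l\<close> in every \<open>I x\<close> now says that \<open>c\<close> is at most the left-hand side.
\<close>

section \<open>Semicontinuity and projections\<close>

lemma closed_epigraph_on:
  fixes f :: "'a::metric_space \<Rightarrow> real"
  assumes "closed S" and lsc: "lower_semicontinuous_on S f"
  shows "closed {(t, r). t \<in> S \<and> f t \<le> r}"
  unfolding closed_sequential_limits
proof (intro allI impI, elim conjE)
  fix z and p assume mem: "\<forall>n. z n \<in> {(t, r). t \<in> S \<and> f t \<le> r}" and lim: "z \<longlonglongrightarrow> p"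
  obtain t r where p: "p = (t, r)" by (cases p)
  have lt: "(\<lambda>n. fst (z n)) \<longlonglongrightarrow> t" and lr: "(\<lambda>n. snd (z n)) \<longlonglongrightarrow> r"
    using tendsto_fst[OF lim] tendsto_snd[OF lim] by (simp_all add: p)
  have zS: "fst (z n) \<in> S" and zr: "f (fst (z n)) \<le> snd (z n)" for n
    using mem by (auto simp: case_prod_beta)
  have tS: "t \<in> S"
    by (rule closed_sequentially[OF \<open>closed S\<close> zS lt])
  have "f t \<le> r"
  proof (rule ccontr)
    assume "\<not> f t \<le> r"
    then obtain d where d: "r < d" "d < f t" using dense not_le by blast
    have "\<forall>\<^sub>F y in at t within S. d < f y"
      using lsc tS d by (auto simp: lower_semicontinuous_on_def)
    then have "\<forall>\<^sub>F y in nhds t. y \<in> S \<longrightarrow> d < f y"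
      unfolding eventually_at_filter
      by (rule eventually_mono) (use d in auto)
    then have "\<forall>\<^sub>F n in sequentially. d < f (fst (z n))"
      using lt zS by (auto simp: filterlim_iff elim: eventually_mono)
    moreover have "\<forall>\<^sub>F n in sequentially. snd (z n) < d"
      using lr d by (simp add: order_tendsto_iff)
    ultimately have "\<forall>\<^sub>F n in sequentially. False"
      by eventually_elim (use zr in \<open>auto simp: not_le dest: less_le_trans order.strict_trans\<close>)
    then show False by simp
  qed
  with tS show "p \<in> {(t, r). t \<in> S \<and> f t \<le> r}" by (simp add: p)
qed

text \<open>
  This makes the end points of a compact-valued family of intervals with closed graph
  semicontinuous, which is where the openness in the separation argument below comes from.
\<close>

lemma closed_projection_along_compact:
  fixes F :: "('a::topological_space \<times> 'b::topological_space) set"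
  assumes "closed F" and "compact K"
  shows "closed {x. \<exists>l\<in>K. (x, l) \<in> F}"
  unfolding closed_def
proof (subst open_subopen, intro ballI)
  fix x assume "x \<in> - {x. \<exists>l\<in>K. (x, l) \<in> F}"
  then have "{x} \<times> K \<subseteq> - F" by auto
  then obtain U where "x \<in> U" "open U" "U \<times> K \<subseteq> - F"
    using Elementary_Topology.tube_lemma[OF \<open>compact K\<close> open_Compl[OF \<open>closed F\<close>]] by metis
  then show "\<exists>T. open T \<and> x \<in> T \<and> T \<subseteq> - {x. \<exists>l\<in>K. (x, l) \<in> F}"
    by (intro exI[where x = U]) auto
qed

section \<open>A common point of a family of intervals\<close>

text \<open>
  Write \<open>I x = [m x, M x]\<close>. If \<open>M y < l < m x\<close>, then \<open>{z. l < m z}\<close> and \<open>{z. M z < l}\<close> are open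
  by the projection lemma, they partition \<open>{z. l \<notin> I z}\<close>, and they contain \<open>x\<close> and \<open>y\<close>
  respectively; this contradicts connectedness. Hence every left end is at most every right end,
  and the supremum of the left ends belongs to all intervals.

  Connectedness is asked only strictly between \<open>a\<close> and \<open>b\<close>, because a point that separates two
  of the intervals is never \<open>a\<close> or \<open>b\<close>. In the application this matters: at the end points the
  parameter may have modulus one, and there the descent direction may fail to exist.
\<close>

lemma intervals_with_connected_missing_sets_share_point:
  fixes I :: "'a::topological_space \<Rightarrow> real set"
  assumes closed_graph: "closed {(x, l). l \<in> I x}"
    and I: "\<And>x. I x \<noteq> {}" "\<And>x. connected (I x)" "\<And>x. I x \<subseteq> {a..b}"
    and missing: "\<And>l. a < l \<Longrightarrow> l < b \<Longrightarrow> connected {x. l \<notin> I x}"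
  shows "\<exists>l. \<forall>x. l \<in> I x"
proof -
  have "compact (I x)" for x
  proof -
    have "closed (Pair x -` {(x, l). l \<in> I x})"
      by (intro closed_vimage closed_graph continuous_intros)
    then have "closed (I x)" by (simp add: vimage_def)
    then show ?thesis
      using I(3) by (metis compact_Icc compact_Int_closed inf.absorb_iff2)
  qed
  then have "\<forall>x. \<exists>s t. I x = {s..t}"
    using I(2) connected_compact_interval_1 by blast
  then obtain m M where mM: "\<And>x. I x = {m x..M x}" by metis
  have le: "m x \<le> M x" "a \<le> m x" "M x \<le> b" for x
    using I(1,3)[of x] by (auto simp: mM)
  have "{x. l < m x} = - {x. \<exists>t\<in>{a..l}. (x, t) \<in> {(x, l). l \<in> I x}}" for l
    using le by (force simp: mM)
  then have open_m: "open {x. l < m x}" for l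
    using closed_projection_along_compact[OF closed_graph, of "{a..l}"] by (simp add: open_Compl)
  have "{x. M x < l} = - {x. \<exists>t\<in>{l..b}. (x, t) \<in> {(x, l). l \<in> I x}}" for l
    using le by (force simp: mM)
  then have open_M: "open {x. M x < l}" for l
    using closed_projection_along_compact[OF closed_graph, of "{l..b}"] by (simp add: open_Compl)
  have mle: "m x \<le> M y" for x y
  proof (rule ccontr)
    assume "\<not> m x \<le> M y"
    then obtain l where l: "M y < l" "l < m x" using dense not_le by blast
    have "a < l" "l < b" using l le[of x] le[of y] by linarith+
    note conn = missing[OF this]
    have "{x. l < m x} \<inter> {x. M x < l} \<inter> {x. l \<notin> I x} = {}"
    proof (intro equals0I, elim IntE CollectE)
      fix z assume "l < m z" "M z < l"
      then show False using le(1)[of z] by linarith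
    qed
    moreover have "{x. l \<notin> I x} \<subseteq> {x. l < m x} \<union> {x. M x < l}"
      by (auto simp: mM)
    ultimately have "{x. l < m x} \<inter> {x. l \<notin> I x} = {} \<or> {x. M x < l} \<inter> {x. l \<notin> I x} = {}"
      by (rule connectedD[OF conn open_m open_M])
    moreover have "x \<in> {x. l < m x} \<inter> {x. l \<notin> I x}" "y \<in> {x. M x < l} \<inter> {x. l \<notin> I x}"
      using l by (auto simp: mM)
    ultimately show False by blast
  qed
  have "(SUP x. m x) \<in> I y" for y
  proof -
    have "m y \<le> (SUP x. m x)"
      by (intro cSUP_upper bdd_aboveI2[where M = "M y"]) (auto simp: mle)
    moreover have "(SUP x. m x) \<le> M y" by (intro cSUP_least) (auto simp: mle)
    ultimately show ?thesis by (simp add: mM)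
  qed
  then show ?thesis by blast
qed

section \<open>Directions of uniform descent\<close>

text \<open>
  Moving along \<open>- u\<close> never leaves the sublevel set. The segment from \<open>x\<close> to \<open>y\<close> may leave it, but
  \<open>g\<close> is bounded above on this compact segment, so a long enough translate of the segment along
  \<open>- u\<close> lies inside the sublevel set and joins the translates of \<open>x\<close> and \<open>y\<close>.
\<close>

lemma connected_strict_sublevel_of_descent_direction:
  fixes g :: "'a::real_normed_vector \<Rightarrow> real"
  assumes cont: "continuous_on UNIV g" and "0 < \<delta>"
    and descent: "\<And>x t. 0 \<le> t \<Longrightarrow> g (x - t *\<^sub>R u) \<le> g x - t * \<delta>"
  shows "connected {x. g x < c}"
  unfolding connected_iff_connected_component
proof (intro ballI)
  fix x y assume x: "x \<in> {x. g x < c}" and y: "y \<in> {x. g x < c}"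
  let ?S = "{x. g x < c}"
  have "compact (closed_segment x y)" "closed_segment x y \<noteq> {}" by auto
  then obtain w where w: "\<And>z. z \<in> closed_segment x y \<Longrightarrow> g z \<le> g w"
    using continuous_attains_sup[OF _ _ continuous_on_subset[OF cont subset_UNIV]] by blast
  (* After time T the drop T * \<delta> exceeds g w - c, and g w is the maximum of g on the segment. *)
  define T where "T = max 0 ((g w - c) / \<delta> + 1)"
  have "0 \<le> T" by (simp add: T_def)
  have "(g w - c) / \<delta> < T" by (simp add: T_def)
  then have T: "g w - T * \<delta> < c" using \<open>0 < \<delta>\<close> by (simp add: field_simps)
  have down: "connected_component ?S z (z - T *\<^sub>R u)" if "g z < c" for z
  proof (rule connected_componentI)
    let ?A = "(\<lambda>t. z - t *\<^sub>R u) ` {0..T}"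
    show "connected ?A"
      by (intro connected_continuous_image continuous_intros) auto
    show "?A \<subseteq> ?S"
    proof clarify
      fix t assume "t \<in> {0..T}"
      then have "g (z - t *\<^sub>R u) \<le> g z - t * \<delta>" "0 \<le> t * \<delta>" using descent \<open>0 < \<delta>\<close> by auto
      then show "g (z - t *\<^sub>R u) < c" using that by linarith
    qed
    show "z \<in> ?A" using \<open>0 \<le> T\<close> by (intro image_eqI[where x = 0]) auto
    show "z - T *\<^sub>R u \<in> ?A" using \<open>0 \<le> T\<close> by auto
  qed
  have "connected_component ?S (x - T *\<^sub>R u) (y - T *\<^sub>R u)"
  proof (rule connected_componentI)
    let ?A = "(\<lambda>z. z - T *\<^sub>R u) ` closed_segment x y"
    show "connected ?A"
      by (intro connected_continuous_image continuous_intros) auto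
    show "?A \<subseteq> ?S"
    proof clarify
      fix z assume "z \<in> closed_segment x y"
      then show "g (z - T *\<^sub>R u) < c"
        using descent[OF \<open>0 \<le> T\<close>, of z] w[of z] T by linarith
    qed
  qed auto
  then show "connected_component ?S x y"
    using down[of x] down[of y] x y
    by (auto intro: connected_component_trans connected_component_sym)
qed

text \<open>
  Since \<open>\<bar>l\<bar> * L\<close> is smaller than the operator norm, some \<open>u\<close> has \<open>\<phi> u > \<bar>l\<bar> * L * norm u\<close>.
  Along \<open>- t u\<close> the linear part loses \<open>t * \<phi> u\<close>, while the perturbation can win back at most
  \<open>t * \<bar>l\<bar> * L * norm u\<close>.
\<close>

lemma descent_direction_of_Lipschitz_perturbation:
  fixes \<phi> \<psi> :: "'a::real_normed_vector \<Rightarrow> real"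
  assumes \<phi>: "bounded_linear \<phi>" and \<psi>: "L-lipschitz_on UNIV \<psi>"
    and small: "\<bar>l\<bar> * L < onorm \<phi>"
  obtains u \<delta> where "0 < \<delta>"
    "\<And>x t. 0 \<le> t \<Longrightarrow> \<phi> (x - t *\<^sub>R u) + l * \<psi> (x - t *\<^sub>R u) \<le> \<phi> x + l * \<psi> x - t * \<delta>"
proof -
  interpret bounded_linear \<phi> by fact
  have "\<exists>u. \<bar>l\<bar> * L * norm u < \<phi> u"
  proof (rule ccontr)
    assume "\<nexists>u. \<bar>l\<bar> * L * norm u < \<phi> u"
    then have *: "\<phi> u \<le> \<bar>l\<bar> * L * norm u" for u by (simp add: not_less)
    have "norm (\<phi> u) \<le> \<bar>l\<bar> * L * norm u" for u
      using *[of u] *[of "- u"] by (simp add: neg abs_le_iff)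
    then have "onorm \<phi> \<le> \<bar>l\<bar> * L"
      using lipschitz_on_nonneg[OF \<psi>] by (intro onorm_bound) auto
    with small show False by simp
  qed
  then obtain u where u: "\<bar>l\<bar> * L * norm u < \<phi> u" by blast
  show ?thesis
  proof
    show "0 < \<phi> u - \<bar>l\<bar> * L * norm u" using u by simp
    fix x and t :: real assume "0 \<le> t"
    have "\<bar>\<psi> (x - t *\<^sub>R u) - \<psi> x\<bar> \<le> L * (t * norm u)"
      using lipschitz_onD[OF \<psi>, of "x - t *\<^sub>R u" x] \<open>0 \<le> t\<close> by (simp add: dist_norm)
    then have "\<bar>l\<bar> * \<bar>\<psi> (x - t *\<^sub>R u) - \<psi> x\<bar> \<le> \<bar>l\<bar> * (L * (t * norm u))"
      by (intro mult_left_mono) auto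
    then have "l * (\<psi> (x - t *\<^sub>R u) - \<psi> x) \<le> \<bar>l\<bar> * (L * (t * norm u))"
      by (metis abs_ge_self abs_mult order_trans)
    then show "\<phi> (x - t *\<^sub>R u) + l * \<psi> (x - t *\<^sub>R u)
        \<le> \<phi> x + l * \<psi> x - t * (\<phi> u - \<bar>l\<bar> * L * norm u)"
      by (simp add: diff scale algebra_simps)
  qed
qed

section \<open>The minimax identity\<close>

theorem theorem1:
  fixes \<phi> \<psi> :: "'a::banach \<Rightarrow> real" and L a b :: real and \<gamma> :: "real \<Rightarrow> real"
  assumes "bounded_linear \<phi>"
    and "\<exists>x. \<phi> x \<noteq> 0"
    and "L = onorm \<phi>"
    and "L-lipschitz_on UNIV \<psi>"
    and "\<not> \<psi> constant_on UNIV"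
    and "a \<le> b"
    and "{a..b} \<subseteq> {-1..1}"
    and "convex_on {a..b} \<gamma>"
    and "lower_semicontinuous_on {a..b} \<gamma>"
  shows "max ((INF x. ereal (\<phi> x + a * \<psi> x)) - ereal (\<gamma> a))
             ((INF x. ereal (\<phi> x + b * \<psi> x)) - ereal (\<gamma> b))
         = (INF x. SUP l\<in>{a..b}. ereal (\<phi> x + l * \<psi> x - \<gamma> l))"
    (is "max (?E a) (?E b) = ?R")
proof (rule antisym)
  have "?E l \<le> ?R" if l: "l \<in> {a..b}" for l
  proof (rule INF_greatest)
    fix x
    have "?E l \<le> ereal (\<phi> x + l * \<psi> x) - ereal (\<gamma> l)"
      by (intro ereal_minus_mono INF_lower) auto
    also have "\<dots> = ereal (\<phi> x + l * \<psi> x - \<gamma> l)" by simp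
    also have "\<dots> \<le> (SUP l\<in>{a..b}. ereal (\<phi> x + l * \<psi> x - \<gamma> l))"
      using l by (rule SUP_upper)
    finally show "?E l \<le> (SUP l\<in>{a..b}. ereal (\<phi> x + l * \<psi> x - \<gamma> l))" .
  qed
  then show "max (?E a) (?E b) \<le> ?R" using \<open>a \<le> b\<close> by simp
next
  show "?R \<le> max (?E a) (?E b)"
  proof (rule ccontr)
    assume "\<not> ?R \<le> max (?E a) (?E b)"
    then have "max (?E a) (?E b) < ?R" by (simp only: not_le)
    from ereal_dense2[OF this]
    obtain c where c: "max (?E a) (?E b) < ereal c" "ereal c < ?R"
      by blast
    define I where "I x = {l \<in> {a..b}. \<gamma> l \<le> \<phi> x + l * \<psi> x - c}" for x
    have cont\<phi>: "continuous_on UNIV \<phi>" by (rule linear_continuous_on[OF assms(1)])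
    have cont\<psi>: "continuous_on UNIV \<psi>" by (rule lipschitz_on_continuous_on[OF assms(4)])
    have "0 < L" using assms(2,3) onorm_pos_lt[OF assms(1)] by simp
    have descent: "\<exists>u \<delta>. 0 < \<delta> \<and> (\<forall>x t. 0 \<le> t \<longrightarrow>
        \<phi> (x - t *\<^sub>R u) + l * \<psi> (x - t *\<^sub>R u) \<le> \<phi> x + l * \<psi> x - t * \<delta>)" if "\<bar>l\<bar> < 1" for l
    proof -
      have "\<bar>l\<bar> * L < onorm \<phi>"
        using mult_strict_right_mono[OF that \<open>0 < L\<close>] assms(3) by simp
      from descent_direction_of_Lipschitz_perturbation[OF assms(1,4) this] show ?thesis
        by metis
    qed
    have "\<exists>l. \<forall>x. l \<in> I x"
    proof (rule intervals_with_connected_missing_sets_share_point)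
      (* The graph of I is the preimage of the epigraph of \<gamma> under a continuous map. *)
      have "closed ((\<lambda>p. (snd p, \<phi> (fst p) + snd p * \<psi> (fst p) - c))
              -` {(t, r). t \<in> {a..b} \<and> \<gamma> t \<le> r})"
        by (intro closed_vimage closed_epigraph_on[OF closed_atLeastAtMost assms(9)] continuous_intros
              continuous_on_compose2[OF cont\<phi>] continuous_on_compose2[OF cont\<psi>] subset_UNIV)
      also have "(\<lambda>p. (snd p, \<phi> (fst p) + snd p * \<psi> (fst p) - c))
              -` {(t, r). t \<in> {a..b} \<and> \<gamma> t \<le> r} = {(x, l). l \<in> I x}"
        by (auto simp: I_def)
      finally show "closed {(x, l). l \<in> I x}" .
    next
      fix x
      have "ereal c < (SUP l\<in>{a..b}. ereal (\<phi> x + l * \<psi> x - \<gamma> l))"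
        using c(2) INF_lower[of x UNIV "\<lambda>x. SUP l\<in>{a..b}. ereal (\<phi> x + l * \<psi> x - \<gamma> l)"]
        by (auto intro: less_le_trans)
      then obtain l where "l \<in> {a..b}" "c < \<phi> x + l * \<psi> x - \<gamma> l"
        by (auto simp: less_SUP_iff)
      then have "l \<in> I x" by (simp add: I_def)
      then show "I x \<noteq> {}" by blast
      have "convex (I x)"
        unfolding convex_def
      proof (intro ballI allI impI)
        fix s t p q :: real
        assume st: "s \<in> I x" "t \<in> I x" and pq: "0 \<le> p" "0 \<le> q" "p + q = 1"
        have "\<gamma> (p *\<^sub>R s + q *\<^sub>R t) \<le> p * \<gamma> s + q * \<gamma> t"
          using assms(8) st pq by (simp add: convex_on_def I_def)
        also have "\<dots> \<le> p * (\<phi> x + s * \<psi> x - c) + q * (\<phi> x + t * \<psi> x - c)"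
          using st pq by (intro add_mono mult_left_mono) (auto simp: I_def)
        also have "\<dots> = (p + q) * (\<phi> x - c) + (p *\<^sub>R s + q *\<^sub>R t) * \<psi> x"
          by (simp add: algebra_simps)
        finally have "\<gamma> (p *\<^sub>R s + q *\<^sub>R t) \<le> \<phi> x + (p *\<^sub>R s + q *\<^sub>R t) * \<psi> x - c"
          using pq by simp
        moreover have "p *\<^sub>R s + q *\<^sub>R t \<in> {a..b}"
          using st pq convexD[OF convex_real_interval(5)] by (auto simp: I_def simp del: atLeastAtMost_iff)
        ultimately show "p *\<^sub>R s + q *\<^sub>R t \<in> I x" by (simp add: I_def)
      qed
      then show "connected (I x)" by (rule convex_connected)
      show "I x \<subseteq> {a..b}" by (auto simp: I_def)
    next
      fix l assume l: "a < l" "l < b"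
      then have "\<bar>l\<bar> < 1" using assms(7) by auto
      then obtain u \<delta> where "0 < \<delta>" and "\<And>x t. 0 \<le> t \<Longrightarrow>
          \<phi> (x - t *\<^sub>R u) + l * \<psi> (x - t *\<^sub>R u) \<le> \<phi> x + l * \<psi> x - t * \<delta>"
        using descent by metis
      then have "connected {x. \<phi> x + l * \<psi> x < \<gamma> l + c}"
        by (intro connected_strict_sublevel_of_descent_direction[where u = u]
              continuous_intros cont\<phi> cont\<psi>)
      also have "{x. \<phi> x + l * \<psi> x < \<gamma> l + c} = {x. l \<notin> I x}"
        using l by (auto simp: I_def)
      finally show "connected {x. l \<notin> I x}" .
    qed
    then obtain l where l: "l \<in> {a..b}" and ge: "\<And>x. \<gamma> l \<le> \<phi> x + l * \<psi> x - c"
      by (auto simp: I_def)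
    have "\<not> \<bar>l\<bar> < 1"
    proof
      assume "\<bar>l\<bar> < 1"
      then obtain u \<delta> where "0 < \<delta>" and des: "\<And>x t. 0 \<le> t \<Longrightarrow>
          \<phi> (x - t *\<^sub>R u) + l * \<psi> (x - t *\<^sub>R u) \<le> \<phi> x + l * \<psi> x - t * \<delta>"
        using descent by metis
      (* This t is chosen so that descending from 0 ends at least 1 below the alleged lower bound
         c + \<gamma> l; it is nonnegative because that bound holds at 0. *)
      define t where "t = (\<phi> 0 + l * \<psi> 0 - c - \<gamma> l + 1) / \<delta>"
      have "0 \<le> t" using ge[of 0] \<open>0 < \<delta>\<close> by (simp add: t_def)
      have "t * \<delta> = \<phi> 0 + l * \<psi> 0 - c - \<gamma> l + 1" using \<open>0 < \<delta>\<close> by (simp add: t_def)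
      with des[OF \<open>0 \<le> t\<close>, of 0] ge[of "0 - t *\<^sub>R u"] show False by linarith
    qed
    then have "l = a \<or> l = b"
      using l assms(7) \<open>a \<le> b\<close> by (auto simp: abs_if split: if_splits)
    moreover have "ereal c \<le> ?E l"
    proof -
      have "ereal (c + \<gamma> l) \<le> (INF x. ereal (\<phi> x + l * \<psi> x))"
        using ge by (intro INF_greatest) (simp add: algebra_simps)
      then show ?thesis by (simp add: ereal_le_minus)
    qed
    ultimately show False using c(1) by auto
  qed
qed

end
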